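(* The approximation ratio of $\textsc{Greedy+Singleton}$ for MSK is no greater than $\beta=0.42945$. That is, there exists an MSK instance $(E,f,w,W)$ and an execution of $\textsc{Greedy+Singleton}$ on it (with ties in $\textsc{Greedy}$ broken arbitrarily) whose output $S$ satisfies $f(S)<0.42945\cdot\max\{f(T): T\subseteq E,\ w(T)\leq W\}$.
   Context: An MSK instance is a tuple $(E,f,w,W)$ where $E$ is a finite set of elements, $f:2^E\to\mathbb{R}_{\geq 0}$ is a non-negative, monotone and submodular set function given by a value oracle, $w:E\to\mathbb{N}_{+}$ is a weight function, and $W\in\mathbb{N}$ is the capacity; for $S\subseteq E$, $w(S)=\sum_{e\in S}w(e)$, and $S$ is feasible if $w(S)\leq W$; the goal is a feasible $S$ maximizing $f(S)$. For $A\subseteq E$, $f_A(S)=f(A\cup S)-f(A)$. The procedure $\textsc{Greedy}(E,f,w,W)$ is: set $E'\leftarrow E$, $A\leftarrow\emptyset$; while $E'\neq\emptyset$: find $e\in E'$ maximizing $f_A(\{e\})/w(e)$ (ties broken arbitrarily), set $E'\leftarrow E'\setminus\{e\}$, and if $w(A\cup\{e\})\leq W$ set $A\leftarrow A\cup\{e\}$; return $A$. The algorithm $\textsc{Greedy+Singleton}$ on $(E,f,w,W)$: compute $A\leftarrow\textsc{Greedy}(E,f,w,W)$; let $e=\arg\max_{e\in E: w(e)\leq W} f(\{e\})$; if $f(A)\geq f(\{e\})$ return $A$, otherwise return $\{e\}$. The approximation ratio of an algorithm is the infimum, over all instances and all executions of the algorithm on them, of the ratio between the value of the output and the optimal value.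 *)

theory Defs
  imports Complex_Main
begin

text \<open>The objective \<open>f\<close> and the weights \<open>w\<close> are total functions in HOL; every condition on them is
  relativised to the ground set \<open>E\<close>, and their values outside \<open>E\<close> are irrelevant.\<close>

definition submodular_on :: "'a set \<Rightarrow> ('a set \<Rightarrow> real) \<Rightarrow> bool" where
  "submodular_on E f \<longleftrightarrow>
     (\<forall>S T. S \<subseteq> E \<longrightarrow> T \<subseteq> E \<longrightarrow> f (S \<union> T) + f (S \<inter> T) \<le> f S + f T)"

definition msk_instance :: "'a set \<Rightarrow> ('a set \<Rightarrow> real) \<Rightarrow> ('a \<Rightarrow> nat) \<Rightarrow> nat \<Rightarrow> bool" where
  "msk_instance E f w W \<longleftrightarrow>
     finite E \<and>
     (\<forall>S. S \<subseteq> E \<longrightarrow> 0 \<le> f S) \<and> mono_on (Pow E) f \<and> submodular_on E f \<and>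
     (\<forall>e\<in>E. 0 < w e)"

definition msk_opt :: "'a set \<Rightarrow> ('a set \<Rightarrow> real) \<Rightarrow> ('a \<Rightarrow> nat) \<Rightarrow> nat \<Rightarrow> real" where
  "msk_opt E f w W = Max {f T |T. T \<subseteq> E \<and> sum w T \<le> W}"

definition marginal :: "('a set \<Rightarrow> real) \<Rightarrow> 'a set \<Rightarrow> 'a set \<Rightarrow> real" where
  "marginal f A S = f (A \<union> S) - f A"

text \<open>\<open>greedy_loop f w W E' A R\<close>: the while loop, entered in state \<open>(E', A)\<close>, can terminate with
  \<open>R\<close>. It is a relation rather than a function because ties are broken arbitrarily.\<close>

inductive greedy_loop ::
  "('a set \<Rightarrow> real) \<Rightarrow> ('a \<Rightarrow> nat) \<Rightarrow> nat \<Rightarrow> 'a set \<Rightarrow> 'a set \<Rightarrow> 'a set \<Rightarrow> bool"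
  for f w W where
  finish: "greedy_loop f w W {} A A"
| iterate: "greedy_loop f w W E' A R"
  if "e \<in> E'"
    and "\<forall>e'\<in>E'. marginal f A {e'} / real (w e') \<le> marginal f A {e} / real (w e)"
    and "greedy_loop f w W (E' - {e}) (if sum w (A \<union> {e}) \<le> W then A \<union> {e} else A) R"

definition greedy ::
  "'a set \<Rightarrow> ('a set \<Rightarrow> real) \<Rightarrow> ('a \<Rightarrow> nat) \<Rightarrow> nat \<Rightarrow> 'a set \<Rightarrow> bool" where
  "greedy E f w W R \<longleftrightarrow> greedy_loop f w W E {} R"

text \<open>If no single element fits into the capacity, the argmax is undefined; the greedy solution
  (which is then empty) is returned.\<close>

definition greedy_singleton ::
  "'a set \<Rightarrow> ('a set \<Rightarrow> real) \<Rightarrow> ('a \<Rightarrow> nat) \<Rightarrow> nat \<Rightarrow> 'a set \<Rightarrow> bool" where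
  "greedy_singleton E f w W S \<longleftrightarrow>
     (\<exists>A. greedy E f w W A \<and>
       (if {e \<in> E. w e \<le> W} = {} then S = A
        else \<exists>e. is_arg_max (\<lambda>e. f {e}) (\<lambda>e. e \<in> E \<and> w e \<le> W) e \<and>
               S = (if f A \<ge> f {e} then A else {e})))"

text \<open>An algorithm is given by its input-output relation. Ground sets are finite sets of naturals,
  which covers every finite ground set up to renaming. Instances of optimal value 0 are left out:
  the ratio 0/0 is undefined there, whereas HOL would evaluate it to 0.\<close>

definition approximation_ratio ::
  "(nat set \<Rightarrow> (nat set \<Rightarrow> real) \<Rightarrow> (nat \<Rightarrow> nat) \<Rightarrow> nat \<Rightarrow> nat set \<Rightarrow> bool) \<Rightarrow> real" where
  "approximation_ratio alg =
     Inf {f S / msk_opt E f w W |E f w W S.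
            msk_instance E f w W \<and> 0 < msk_opt E f w W \<and> alg E f w W S}"

end

theory Submission
  imports Defs
begin

text \<open>The optimum consists of two heavy elements of weight \<open>w\<close> and value \<open>w\<close> and one light element of
  weight \<open>m\<close> and larger density; together they fill the capacity \<open>W = 2 w + m\<close> exactly. In
  addition there are \<open>w + 1\<close> decoys of weight 1, each of which overlaps with the optimum just enough
  to tie with the best remaining density. The first \<open>a\<close> decoys cover only the light element, until
  its density has dropped to that of the heavy ones; the other \<open>b\<close> decoys cover all three elements
  in proportion to their residual values. Greedy may take all the decoys and then the light element,
  after which no heavy element fits.\<close>

section \<open>Truncated additive functions; general facts on Greedy and the ratio\<close>

lemma submodular_on_min_sum:
  fixes v :: real and c :: "'a \<Rightarrow> real"
  assumes "finite E" and nn: "\<And>x. x \<in> E \<Longrightarrow> 0 \<le> c x"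
  shows "submodular_on E (\<lambda>S. min v (sum c S))"
  unfolding submodular_on_def
proof (intro allI impI)
  fix S T assume ST: "S \<subseteq> E" "T \<subseteq> E"
  then have fin: "finite S" "finite T" using assms(1) finite_subset by auto
  have 1: "sum c (S \<union> T) + sum c (S \<inter> T) = sum c S + sum c T"
    using sum.union_inter[OF fin, of c] .
  have 2: "sum c (S \<inter> T) \<le> sum c S" "sum c (S \<inter> T) \<le> sum c T"
    using fin ST nn by (auto intro!: sum_mono2)
  \<comment> \<open>Concavity of \<open>min v\<close>: the sums over union and intersection have the
    same total as those over \<open>S\<close> and \<open>T\<close>, but lie further apart.\<close>
  show "min v (sum c (S \<union> T)) + min v (sum c (S \<inter> T)) \<le> min v (sum c S) + min v (sum c T)"
    using 1 2 by linarith
qed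

lemma mono_on_min_sum:
  fixes v :: real and c :: "'a \<Rightarrow> real"
  assumes "finite E" "\<And>x. x \<in> E \<Longrightarrow> 0 \<le> c x"
  shows "mono_on (Pow E) (\<lambda>S. min v (sum c S))"
proof (rule mono_onI)
  fix S T assume "S \<in> Pow E" "T \<in> Pow E" "S \<le> T"
  then have "sum c S \<le> sum c T"
    using assms by (intro sum_mono2) (auto intro: finite_subset)
  then show "min v (sum c S) \<le> min v (sum c T)" by linarith
qed

lemma submodular_on_add:
  "submodular_on E f \<Longrightarrow> submodular_on E g \<Longrightarrow> submodular_on E (\<lambda>S. f S + g S)"
  unfolding submodular_on_def by (smt (verit))

lemma mono_on_add:
  fixes f g :: "'a::order \<Rightarrow> real"
  shows "mono_on A f \<Longrightarrow> mono_on A g \<Longrightarrow> mono_on A (\<lambda>x. f x + g x)"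
  by (auto simp: mono_on_def intro: add_mono)

lemma greedy_loop_subset:
  "greedy_loop f w W E A R \<Longrightarrow> R \<subseteq> A \<union> E"
  by (induction rule: greedy_loop.induct) (auto split: if_splits)

lemma ex_is_arg_max_if_finite:
  fixes f :: "'a \<Rightarrow> 'b::linorder"
  assumes "finite A" "A \<noteq> {}"
  shows "\<exists>x. is_arg_max f (\<lambda>x. x \<in> A) x"
proof -
  have "Max (f ` A) \<in> f ` A" using assms by simp
  then obtain x where "x \<in> A" "f x = Max (f ` A)" by auto
  then show ?thesis
    using assms by (auto simp: is_arg_max_linorder intro!: exI[of _ x])
qed

lemma msk_opt_ge:
  assumes "finite E" "T \<subseteq> E" "sum w T \<le> W"
  shows "f T \<le> msk_opt E f w W"
  unfolding msk_opt_def
proof (rule Max_ge)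
  have "{f T |T. T \<subseteq> E \<and> sum w T \<le> W} \<subseteq> f ` Pow E" by auto
  then show "finite {f T |T. T \<subseteq> E \<and> sum w T \<le> W}"
    using assms(1) finite_subset by blast
  show "f T \<in> {f T |T. T \<subseteq> E \<and> sum w T \<le> W}" using assms by blast
qed

lemma greedy_singleton_subset:
  assumes "greedy_singleton E f w W S"
  shows "S \<subseteq> E"
proof -
  obtain A where A: "greedy E f w W A"
    and S: "if {e \<in> E. w e \<le> W} = {} then S = A
        else \<exists>e. is_arg_max (\<lambda>e. f {e}) (\<lambda>e. e \<in> E \<and> w e \<le> W) e \<and>
               S = (if f A \<ge> f {e} then A else {e})"
    using assms unfolding greedy_singleton_def by blast
  have "A \<subseteq> E" using greedy_loop_subset A unfolding greedy_def by fastforce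
  with S show ?thesis by (auto simp: is_arg_max_def split: if_splits)
qed

text \<open>The best singleton need not be identified: by monotonicity those inside \<open>A\<close>
  are worth at most \<open>f A\<close>, so only elements outside \<open>A\<close> need a
  bound.\<close>

lemma ex_greedy_singleton:
  assumes E: "finite E" and mono: "mono_on (Pow E) f"
    and A: "greedy E f w W A" "f A \<le> B" and out: "\<And>e. e \<in> E - A \<Longrightarrow> f {e} \<le> B"
  shows "\<exists>S. greedy_singleton E f w W S \<and> f S \<le> B"
proof (cases "{e \<in> E. w e \<le> W} = {}")
  case True
  then show ?thesis using A unfolding greedy_singleton_def by auto
next
  case False
  then obtain e where e: "is_arg_max (\<lambda>e. f {e}) (\<lambda>e. e \<in> E \<and> w e \<le> W) e"
    using ex_is_arg_max_if_finite[of "{e \<in> E. w e \<le> W}" "\<lambda>e. f {e}"] E by auto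
  have sub: "A \<subseteq> E" using greedy_loop_subset A(1) unfolding greedy_def by fastforce
  have "f {e} \<le> B" if "e \<in> A"
    using mono_onD[OF mono, of "{e}" A] that sub A(2) by auto
  moreover have "e \<in> E" using e by (auto simp: is_arg_max_def)
  ultimately have "f {e} \<le> B" using out by blast
  then show ?thesis
    using e A False unfolding greedy_singleton_def
    by (intro exI[of _ "if f A \<ge> f {e} then A else {e}"]) (auto intro!: exI[of _ A])
qed

lemma approximation_ratio_le:
  assumes I: "msk_instance E f w W" and alg: "alg E f w W S" and opt: "0 < msk_opt E f w W"
    and sub: "\<And>E f w W S. alg E f w W S \<Longrightarrow> S \<subseteq> E"
  shows "approximation_ratio alg \<le> f S / msk_opt E f w W"
  unfolding approximation_ratio_def
proof (rule cInf_lower)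
  \<comment> \<open>\<open>Inf\<close> on the reals needs a lower bound; 0 serves, as outputs lie in
    the ground set, where \<open>f\<close> is non-negative.\<close>
  show "bdd_below {f S / msk_opt E f w W |E f w W S.
            msk_instance E f w W \<and> 0 < msk_opt E f w W \<and> alg E f w W S}"
    using sub by (intro bdd_belowI[of _ 0]) (fastforce simp: msk_instance_def)
qed (use assms in blast)

section \<open>The trap instance\<close>

locale greedy_trap =
  fixes m w a b :: nat
  assumes m: "2 \<le> m" and w: "m \<le> w" and ab: "a + b = w + 1"
begin

definition n :: nat where "n = a + b"
definition W :: nat where "W = 2 * w + m"

lemma n: "n = w + 1"
  using ab by (simp add: n_def)

text \<open>Factors by which one decoy shrinks the residual densities it affects. Covering total
  weight \<open>M\<close> proportionally gains \<open>M * (1 - r)\<close> times the density, so a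
  tie at weight 1 forces \<open>r = 1 - 1 / M\<close>; \<open>M\<close> is \<open>m\<close> in the
  first phase and \<open>W\<close> in the second.\<close>

definition p :: real where "p = 1 - 1 / m"
definition q :: real where "q = 1 - 1 / W"

text \<open>\<open>d k\<close> and \<open>u k\<close> are the residual densities of the light and of the heavy elements once the decoys
  \<open>0, \<dots>, k - 1\<close> have been chosen. Truncated subtraction makes \<open>u\<close> constant on \<open>{..a}\<close>.\<close>

definition u :: "nat \<Rightarrow> real" where "u k = q ^ (k - a)"
definition d :: "nat \<Rightarrow> real" where "d k = u k / p ^ (a - k)"
definition v :: real where "v = m * d 0"

text \<open>The decoys are \<open>{..<n}\<close>, the heavy elements \<open>n\<close> and \<open>n + 1\<close>, the light one \<open>n + 2\<close>. The
  amount by which the decoy \<open>j\<close> covers the heavy element \<open>x\<close> is \<open>c x j\<close>, and \<open>c' j\<close> is the amount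
  for the light element.\<close>

definition c :: "nat \<Rightarrow> nat \<Rightarrow> real" where
  "c x j = (if j < n then w * (u j - u (Suc j)) else if j = x then w else 0)"

definition c' :: "nat \<Rightarrow> real" where
  "c' j = (if j < n then m * (d j - d (Suc j)) else if j = Suc (Suc n) then v else 0)"

text \<open>Each summand is the covered part of one optimal element, capped at its value, so
  \<open>f\<close> is a sum of truncated additive functions.\<close>

definition f :: "nat set \<Rightarrow> real" where
  "f S = min w (sum (c n) S) + min w (sum (c (Suc n)) S) + min v (sum c' S)"

definition wt :: "nat \<Rightarrow> nat" where
  "wt j = (if j < n then 1 else if j < n + 2 then w else m)"

definition E :: "nat set" where "E = {..<n + 3}"

lemma p: "0 < p" "p < 1" and q: "0 < q" "q < 1"
  using m w by (auto simp: p_def q_def W_def field_simps)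

lemma u_pos: "0 < u k" and d_pos: "0 < d k"
  using p q by (auto simp: u_def d_def)

lemma u_antimono: "i \<le> j \<Longrightarrow> u j \<le> u i"
  using q unfolding u_def by (intro power_decreasing) auto

lemma d_antimono: "i \<le> j \<Longrightarrow> d j \<le> d i"
  unfolding d_def using p u_pos[of i] u_antimono
  by (intro frac_le) (auto intro: power_decreasing less_imp_le)

lemma u_le_d: "u k \<le> d k"
  using p u_pos[of k] by (auto simp: d_def field_simps power_le_one)

lemma c_nonneg: "0 \<le> c x j"
  using u_antimono[of j "Suc j"] by (auto simp: c_def)

lemma c'_nonneg: "0 \<le> c' j"
  using d_antimono[of j "Suc j"] d_pos[of 0] by (auto simp: c'_def v_def)

text \<open>This is the tie. For \<open>j < a\<close>, \<open>u\<close> is constant and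
  \<open>d (Suc j) = p * d j\<close>, so only the light element contributes; from \<open>a\<close>
  on, \<open>d = u\<close> and all three contribute with total weight \<open>W\<close>.\<close>

lemma decoy_gain: "j < n \<Longrightarrow> c n j + c (Suc n) j + c' j = d j"
proof -
  assume j: "j < n"
  show ?thesis
  proof (cases "j < a")
    case True
    then have "p ^ (a - j) = p * p ^ (a - Suc j)"
      by (metis Suc_diff_Suc power_Suc)
    then show ?thesis using True j p m
      by (simp add: c_def c'_def d_def u_def field_simps) (simp add: p_def field_simps)
  next
    case False
    then have "q ^ (Suc j - a) = q * q ^ (j - a)"
      by (simp add: Suc_diff_le)
    then have "u j - u (Suc j) = u j / W" using False by (simp add: u_def q_def left_diff_distrib)
    moreover have "c n j + c (Suc n) j + c' j = W * (u j - u (Suc j))"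
      using False j by (simp add: c_def c'_def d_def W_def algebra_simps)
    ultimately show ?thesis using False m by (simp add: d_def W_def)
  qed
qed

lemma sum_c: "k \<le> n \<Longrightarrow> sum (c x) {..<k} = w * (1 - u k)"
proof -
  assume k: "k \<le> n"
  have "sum (c x) {..<k} = (\<Sum>j<k. w * (u j - u (Suc j)))"
    using k by (intro sum.cong) (auto simp: c_def)
  also have "\<dots> = w * (u 0 - u k)"
    by (simp add: sum_distrib_left[symmetric] sum_lessThan_telescope')
  finally show ?thesis by (simp add: u_def)
qed

lemma sum_c': "k \<le> n \<Longrightarrow> sum c' {..<k} = m * (d 0 - d k)"
proof -
  assume k: "k \<le> n"
  have "sum c' {..<k} = (\<Sum>j<k. m * (d j - d (Suc j)))"
    using k by (intro sum.cong) (auto simp: c'_def)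
  also have "\<dots> = m * (d 0 - d k)"
    by (simp add: sum_distrib_left[symmetric] sum_lessThan_telescope')
  finally show ?thesis .
qed

text \<open>All decoys together cover only \<open>w * (1 - u n) < w\<close>, so the cap takes effect
  only through \<open>x\<close> itself.\<close>

lemma min_c:
  assumes "S \<subseteq> E" "x \<in> {n, Suc n}"
  shows "min w (sum (c x) S) = (if x \<in> S then w else sum (c x) (S \<inter> {..<n}))"
proof -
  have fin: "finite S" using assms(1) finite_subset by (auto simp: E_def)
  have *: "sum (c x) (S \<inter> {..<n}) \<le> w"
  proof -
    have "sum (c x) (S \<inter> {..<n}) \<le> sum (c x) {..<n}"
      by (intro sum_mono2) (auto simp: c_nonneg)
    also have "\<dots> \<le> w" using u_pos[of n] by (simp add: sum_c algebra_simps)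
    finally show ?thesis .
  qed
  show ?thesis
  proof (cases "x \<in> S")
    case True
    have "w = sum (c x) {x}" using assms by (auto simp: c_def)
    also have "\<dots> \<le> sum (c x) S" using True fin by (intro sum_mono2) (auto simp: c_nonneg)
    finally show ?thesis using True by simp
  next
    case False
    then have "sum (c x) S = sum (c x) (S \<inter> {..<n})"
      using fin assms by (intro sum.mono_neutral_right) (auto simp: c_def)
    then show ?thesis using False * by simp
  qed
qed

lemma min_c':
  assumes "S \<subseteq> E"
  shows "min v (sum c' S) = (if Suc (Suc n) \<in> S then v else sum c' (S \<inter> {..<n}))"
proof -
  have fin: "finite S" using assms(1) finite_subset by (auto simp: E_def)
  have *: "sum c' (S \<inter> {..<n}) \<le> v"
  proof -
    have "sum c' (S \<inter> {..<n}) \<le> sum c' {..<n}"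
      by (intro sum_mono2) (auto simp: c'_nonneg)
    also have "\<dots> \<le> v" using d_pos[of n] by (simp add: sum_c' v_def algebra_simps)
    finally show ?thesis .
  qed
  show ?thesis
  proof (cases "Suc (Suc n) \<in> S")
    case True
    have "v = sum c' {Suc (Suc n)}" by (auto simp: c'_def)
    also have "\<dots> \<le> sum c' S" using True fin by (intro sum_mono2) (auto simp: c'_nonneg)
    finally show ?thesis using True by simp
  next
    case False
    then have "sum c' S = sum c' (S \<inter> {..<n})"
      using fin assms by (intro sum.mono_neutral_right) (auto simp: c'_def)
    then show ?thesis using False * by simp
  qed
qed

lemma f_eq:
  assumes "S \<subseteq> E"
  shows "f S = (if n \<in> S then w else sum (c n) (S \<inter> {..<n}))
    + (if Suc n \<in> S then w else sum (c (Suc n)) (S \<inter> {..<n}))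
    + (if Suc (Suc n) \<in> S then v else sum c' (S \<inter> {..<n}))"
  unfolding f_def
  using min_c[OF assms, of n] min_c[OF assms, of "Suc n"] min_c'[OF assms] by simp

lemma f_decoys: "S \<subseteq> {..<n} \<Longrightarrow> f S = sum d S"
proof -
  assume S: "S \<subseteq> {..<n}"
  then have "S \<subseteq> E" "S \<inter> {..<n} = S" "n \<notin> S" "Suc n \<notin> S" "Suc (Suc n) \<notin> S" by (auto simp: E_def)
  then have "f S = (\<Sum>j\<in>S. c n j + c (Suc n) j + c' j)"
    by (simp add: f_eq sum.distrib)
  also have "\<dots> = sum d S" using S by (intro sum.cong) (auto simp: decoy_gain)
  finally show ?thesis .
qed

section \<open>Validity of the instance and its greedy execution\<close>

lemma msk_instance_trap: "msk_instance E f wt W"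
  unfolding msk_instance_def
proof (intro conjI allI impI ballI)
  show fin: "finite E" by (simp add: E_def)
  show "0 \<le> f S" if "S \<subseteq> E" for S
    using d_pos[of 0] by (auto simp: f_def v_def intro!: add_nonneg_nonneg sum_nonneg c_nonneg c'_nonneg)
  show "mono_on (Pow E) f"
    unfolding f_def by (intro mono_on_add mono_on_min_sum fin c_nonneg c'_nonneg)
  show "submodular_on E f"
    unfolding f_def by (intro submodular_on_add submodular_on_min_sum fin c_nonneg c'_nonneg)
  show "0 < wt e" if "e \<in> E" for e
    using m w by (auto simp: wt_def)
qed

lemma greedy_trap_output: "greedy E f wt W (insert (Suc (Suc n)) {..<n})"
proof -
  let ?G = "greedy_loop f wt W"
  let ?A = "insert (Suc (Suc n)) {..<n}"
  have fA: "f ?A = 2 * w * (1 - u n) + v"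
    by (subst f_eq) (simp_all add: E_def Int_insert_left sum_c)
  have fA1: "f (insert n ?A) = w + w * (1 - u n) + v"
    by (subst f_eq) (simp_all add: E_def Int_insert_left sum_c)
  have fA2: "f (insert (Suc n) ?A) = w + w * (1 - u n) + v"
    by (subst f_eq) (simp_all add: E_def Int_insert_left sum_c)
  have wtA: "sum wt ?A = n + m" by (simp add: wt_def)
  \<comment> \<open>The run is built backwards from its last iteration. Decoys and light element
    weigh \<open>w + 1 + m\<close>, so a heavy element would exceed \<open>W\<close> by exactly
    1.\<close>
  have 1: "?G {Suc n} ?A ?A"
  proof (rule greedy_loop.iterate[where e = "Suc n"])
    show "?G ({Suc n} - {Suc n}) (if sum wt (?A \<union> {Suc n}) \<le> W then ?A \<union> {Suc n} else ?A) ?A"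
      using wtA n w m by (simp add: wt_def W_def greedy_loop.finish)
  qed auto
  have 2: "?G {n, Suc n} ?A ?A"
  proof (rule greedy_loop.iterate[where e = n])
    show "?G ({n, Suc n} - {n}) (if sum wt (?A \<union> {n}) \<le> W then ?A \<union> {n} else ?A) ?A"
      using wtA n w m 1 by (auto simp: wt_def W_def)
  qed (use fA1 fA2 in \<open>auto simp: marginal_def wt_def\<close>)
  have fk: "f {..<k} = 2 * w * (1 - u k) + m * (d 0 - d k)" if "k \<le> n" for k
    using that by (subst f_eq) (simp_all add: E_def sum_c sum_c' Int_absorb2)
  \<comment> \<open>After \<open>k\<close> decoys the remaining decoys offer density
    \<open>d j\<close>, the heavy elements \<open>u k\<close>, and the light one exactly
    \<open>d k\<close>.\<close>
  have marg: "marginal f {..<k} {j} / wt j \<le> d k" if "k \<le> n" "k \<le> j" and j: "j < n + 3" for k j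
  proof -
    consider "j < n" | "j = n" | "j = Suc n" | "j = Suc (Suc n)"
      using j by linarith
    then show ?thesis
    proof cases
      case 1
      then have "marginal f {..<k} {j} = d j"
        using that by (simp add: marginal_def f_decoys)
      then show ?thesis using 1 d_antimono that by (simp add: wt_def)
    next
      case 2
      then have "f ({..<k} \<union> {j}) = w + w * (1 - u k) + m * (d 0 - d k)"
        using that by (subst f_eq) (simp_all add: E_def sum_c sum_c' Int_absorb2)
      then have "marginal f {..<k} {j} = w * u k"
        using that by (simp add: marginal_def fk algebra_simps)
      then show ?thesis using 2 u_le_d w m by (simp add: wt_def)
    next
      case 3
      then have "f ({..<k} \<union> {j}) = w + w * (1 - u k) + m * (d 0 - d k)"
        using that by (subst f_eq) (simp_all add: E_def sum_c sum_c' Int_absorb2)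
      then have "marginal f {..<k} {j} = w * u k"
        using that by (simp add: marginal_def fk algebra_simps)
      then show ?thesis using 3 u_le_d w m by (simp add: wt_def)
    next
      case 4
      then have "f ({..<k} \<union> {j}) = 2 * w * (1 - u k) + v"
        using that by (subst f_eq) (simp_all add: E_def sum_c sum_c' Int_absorb2)
      then have "marginal f {..<k} {j} = m * d k"
        using that by (simp add: marginal_def fk v_def algebra_simps)
      then show ?thesis using 4 m by (simp add: wt_def)
    qed
  qed
  have 3: "?G {n..<n + 3} {..<n} ?A"
  proof (rule greedy_loop.iterate[where e = "Suc (Suc n)"])
    have "marginal f {..<n} {Suc (Suc n)} = m * d n"
      using fA fk[of n] by (simp add: marginal_def v_def algebra_simps)
    then show "\<forall>e'\<in>{n..<n + 3}. marginal f {..<n} {e'} / wt e' \<le> marginal f {..<n} {Suc (Suc n)} / wt (Suc (Suc n))"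
      using marg[of n] m by (simp add: wt_def)
    have "{n..<n + 3} - {Suc (Suc n)} = {n, Suc n}" by auto
    moreover have "sum wt ({..<n} \<union> {Suc (Suc n)}) \<le> W" using wtA n w m by (simp add: W_def)
    ultimately show "?G ({n..<n + 3} - {Suc (Suc n)})
        (if sum wt ({..<n} \<union> {Suc (Suc n)}) \<le> W then {..<n} \<union> {Suc (Suc n)} else {..<n}) ?A"
      using 2 by simp
  qed auto
  \<comment> \<open>Downward induction on \<open>k\<close>: decoy \<open>k\<close> and the light
    element tie at density \<open>d k\<close>, and the decoy is taken.\<close>
  have "?G {k..<n + 3} {..<k} ?A" if "k \<le> n" for k
    using that
  proof (induction k rule: inc_induct)
    case base
    show ?case by (rule 3)
  next
    case (step k)
    show ?case
    proof (rule greedy_loop.iterate[where e = k])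
      have "marginal f {..<k} {k} = d k"
        using step by (simp add: marginal_def f_decoys)
      then show "\<forall>e'\<in>{k..<n + 3}. marginal f {..<k} {e'} / wt e' \<le> marginal f {..<k} {k} / wt k"
        using marg[of k] step by (simp add: wt_def)
      have "{k..<n + 3} - {k} = {Suc k..<n + 3}" "{..<k} \<union> {k} = {..<Suc k}" by auto
      moreover have "sum wt {..<Suc k} \<le> W"
        using step n w m by (simp add: wt_def W_def)
      ultimately show "?G ({k..<n + 3} - {k})
          (if sum wt ({..<k} \<union> {k}) \<le> W then {..<k} \<union> {k} else {..<k}) ?A"
        using step by simp
    qed (use step in auto)
  qed
  from this[of 0] show ?thesis by (simp add: greedy_def E_def lessThan_atLeast0)
qed

lemma f_opt: "f {n, Suc n, Suc (Suc n)} = 2 * w + v"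
  by (subst f_eq) (simp_all add: E_def)

lemma f_greedy: "f (insert (Suc (Suc n)) {..<n}) = 2 * w * (1 - q ^ b) + v"
  by (subst f_eq) (simp_all add: E_def Int_insert_left sum_c u_def n_def)

lemma ratio_bound:
  assumes single: "w < r * (2 * w + v)" and greedy: "2 * w * (1 - q ^ b) + v < r * (2 * w + v)"
    and r: "0 \<le> r"
  shows "\<exists>S. msk_instance E f wt W \<and> greedy_singleton E f wt W S \<and> f S < r * msk_opt E f wt W"
proof -
  have I: "finite E" "mono_on (Pow E) f" using msk_instance_trap by (auto simp: msk_instance_def)
  \<comment> \<open>Bounds either possible output: outside the greedy set the only singletons are
    the heavy ones, of value \<open>w\<close>.\<close>
  define B where "B = max w (2 * w * (1 - q ^ b) + v)"
  have "f {e} \<le> B" if "e \<in> E - insert (Suc (Suc n)) {..<n}" for e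
  proof -
    have "e = n \<or> e = Suc n" using that by (auto simp: E_def)
    then have "f {e} = w" by (subst f_eq) (auto simp: E_def)
    then show ?thesis by (simp add: B_def)
  qed
  then obtain S where S: "greedy_singleton E f wt W S" "f S \<le> B"
    using ex_greedy_singleton[OF I greedy_trap_output, of B] f_greedy by (auto simp: B_def)
  have "2 * w + v \<le> msk_opt E f wt W"
    using msk_opt_ge[OF I(1), of "{n, Suc n, Suc (Suc n)}" wt W f]
    by (simp add: f_opt E_def wt_def W_def)
  then have "B < r * msk_opt E f wt W"
    using single greedy mult_left_mono[OF _ r] unfolding B_def by (smt (verit))
  then show ?thesis using S msk_instance_trap by (intro exI[of _ S]) auto
qed

end

section \<open>Exponential bounds and numerical verification\<close>

lemma exp_ge_taylor_even:
  fixes x :: real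
  assumes "even n"
  shows "(\<Sum>k<n. x ^ k / fact k) \<le> exp x"
proof -
  obtain t where "exp x = (\<Sum>k<n. x ^ k / fact k) + exp t / fact n * x ^ n"
    using Maclaurin_exp_le by blast
  \<comment> \<open>An even exponent makes the remainder non-negative for negative \<open>x\<close>
    too.\<close>
  moreover have "0 \<le> exp t / fact n * x ^ n"
    using assms by (intro mult_nonneg_nonneg) (auto simp: zero_le_even_power)
  ultimately show ?thesis by linarith
qed

lemma one_minus_power_le_exp:
  fixes x :: real
  assumes "x \<le> 1"
  shows "(1 - x) ^ k \<le> exp (- (k * x))"
proof -
  have "(1 - x) ^ k \<le> exp (- x) ^ k"
    using assms exp_ge_add_one_self[of "- x"] by (intro power_mono) auto
  then show ?thesis by (simp add: exp_of_nat_mult[symmetric])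
qed

text \<open>\<open>1 - 1 / x\<close> is the inverse of \<open>1 + 1 / (x - 1)\<close>, to which
  \<open>1 + y \<le> exp y\<close> applies; hence the shift to \<open>x - 1\<close>.\<close>

lemma exp_le_one_minus_power:
  fixes x :: real
  assumes "1 < x"
  shows "exp (- (k / (x - 1))) \<le> (1 - 1 / x) ^ k"
proof -
  have "exp (- (1 / (x - 1))) = inverse (exp (1 / (x - 1)))" by (simp add: exp_minus)
  also have "\<dots> \<le> inverse (1 + 1 / (x - 1))"
    using assms by (intro le_imp_inverse_le exp_ge_add_one_self) (auto simp: add_pos_pos)
  also have "\<dots> = 1 - 1 / x" using assms by (simp add: field_simps)
  finally have "exp (- (1 / (x - 1))) ^ k \<le> (1 - 1 / x) ^ k" by (intro power_mono) auto
  then show ?thesis by (simp add: exp_of_nat_mult[symmetric])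
qed

text \<open>As \<open>m, w, a \<rightarrow> \<infinity>\<close> in fixed proportions, the ratio of the trap tends to a limit of
  about \<open>0.4294398\<close> for the best proportions. The slack below \<open>0.42945\<close> being about \<open>0.00001\<close>, a
  capacity of \<open>1000000\<close> brings the discretisation error well below it.\<close>

interpretation trap: greedy_trap 83400 458300 49290 409011
  by unfold_locales auto

lemma trap_p: "trap.p = 1 - 1 / 83400" and trap_q: "trap.q = 1 - 1 / 1000000"
  by (simp_all add: trap.p_def trap.q_def trap.W_def)

lemma trap_p_le: "trap.p ^ 49290 \<le> 0.5538"
proof -
  have "trap.p ^ 49290 \<le> exp (- (real 49290 * (1 / 83400)))"
    unfolding trap_p by (rule one_minus_power_le_exp) simp
  also have "\<dots> = inverse (exp (49290 / 83400))" by (simp add: exp_minus)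
  \<comment> \<open>The reciprocal turns a lower Taylor bound at a positive argument into an upper
    bound.\<close>
  also have "\<dots> \<le> inverse (\<Sum>k<6. (49290 / 83400) ^ k / fact k)"
    by (intro le_imp_inverse_le exp_ge_taylor_even) (simp, simp add: eval_nat_numeral)
  also have "\<dots> \<le> 0.5538"
    by (simp add: eval_nat_numeral)
  finally show ?thesis .
qed

lemma trap_p_ge: "0.55376 \<le> trap.p ^ 49290"
proof -
  have "0.55376 \<le> (\<Sum>k<8. (- (49290 / 83399 :: real)) ^ k / fact k)"
    by (simp add: eval_nat_numeral)
  also have "\<dots> \<le> exp (- (49290 / 83399))" by (rule exp_ge_taylor_even) simp
  also have "\<dots> = exp (- (real 49290 / (83400 - 1)))" by simp
  also have "\<dots> \<le> trap.p ^ 49290"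
    unfolding trap_p by (rule exp_le_one_minus_power) simp
  finally show ?thesis .
qed

lemma trap_q_ge: "0.664306 \<le> trap.q ^ 409011"
proof -
  have "0.664306 \<le> (\<Sum>k<8. (- (409011 / 999999 :: real)) ^ k / fact k)"
    by (simp add: eval_nat_numeral)
  also have "\<dots> \<le> exp (- (409011 / 999999))" by (rule exp_ge_taylor_even) simp
  also have "\<dots> = exp (- (real 409011 / (1000000 - 1)))" by simp
  also have "\<dots> \<le> trap.q ^ 409011"
    unfolding trap_q by (rule exp_le_one_minus_power) simp
  finally show ?thesis .
qed

theorem theorem1p2:
  shows "approximation_ratio greedy_singleton \<le> 0.42945 \<and>
    (\<exists>(E :: nat set) (f :: nat set \<Rightarrow> real) (w :: nat \<Rightarrow> nat) (W :: nat) (S :: nat set).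
       msk_instance E f w W \<and> greedy_singleton E f w W S \<and>
       f S < 0.42945 * msk_opt E f w W)"
proof -
  have v: "trap.v = 83400 / trap.p ^ 49290" by (simp add: trap.v_def trap.d_def trap.u_def)
  \<comment> \<open>The heavy singleton and the greedy set are worth almost the same here. The lower
    bound on \<open>trap.v\<close> serves the former, the upper bound the latter.\<close>
  have "83400 / 0.5538 \<le> trap.v" "trap.v \<le> 83400 / 0.55376"
    unfolding v using trap_p_le trap_p_ge trap.p by (intro divide_left_mono; simp)+
  then have "458300 < 0.42945 * (2 * 458300 + trap.v)"
    "2 * 458300 * (1 - trap.q ^ 409011) + trap.v < 0.42945 * (2 * 458300 + trap.v)"
    using trap_q_ge by auto
  then have "\<exists>S. msk_instance trap.E trap.f trap.wt trap.W \<and>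
      greedy_singleton trap.E trap.f trap.wt trap.W S \<and>
      trap.f S < 0.42945 * msk_opt trap.E trap.f trap.wt trap.W"
    by (intro trap.ratio_bound) simp_all
  then obtain E :: "nat set" and f w W S where *: "msk_instance E f w W"
      "greedy_singleton E f w W S" "f S < 0.42945 * msk_opt E f w W"
    by blast
  \<comment> \<open>With the strict inequality this makes the optimum positive, as the ratio
    requires.\<close>
  have "0 \<le> f S"
    using *(1) greedy_singleton_subset[OF *(2)] unfolding msk_instance_def by blast
  then have opt: "0 < msk_opt E f w W" using *(3) by simp
  have "approximation_ratio greedy_singleton \<le> f S / msk_opt E f w W"
    using *(1,2) opt greedy_singleton_subset by (rule approximation_ratio_le)
  also have "\<dots> \<le> 0.42945" using *(3) opt by (simp add: pos_divide_le_eq)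
  finally show ?thesis using * by blast
qed

end
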